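(* Let $X$ be a compact metric space of packing dimension $k$, where $k<\infty$ is such that $N:=2k+1$ is an integer. Then $X$ can be embedded in $\mathbb E^N$ via a Lipschitz map, i.e. there exists a Lipschitz map $f:X\to\mathbb E^N$ that is a homeomorphism onto its image.
   Context: $\mathbb E^N$ denotes $\mathbb R^N$ with the Euclidean distance. The packing dimension of a metric space $X$ is the standard one: $\dim_P X=\inf\{\sup_i \overline{\dim}_B X_i : X=\bigcup_{i\in\mathbb N}X_i\}$, where $\overline{\dim}_B$ is the upper box-counting (Minkowski) dimension and the infimum is over countable covers of $X$ by (bounded) subsets. *)

theory Defs
  imports "HOL-Analysis.Analysis"
begin

(* The diameter of an unbounded set is unspecified in the library, hence the condition
   "bounded U".  Replacing the members of F by their traces on A changes nothing, so the
   number does not depend on the ambient type.  For A not totally bounded the LEAST may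
   range over the empty set; upper_box_dim does not use the value there. *)
definition covering_number :: "real \<Rightarrow> 'a::metric_space set \<Rightarrow> nat" where
  "covering_number \<epsilon> A =
     (LEAST n. \<exists>F. finite F \<and> card F = n \<and> A \<subseteq> \<Union>F \<and>
                   (\<forall>U\<in>F. bounded U \<and> diameter U \<le> \<epsilon>))"

(* The empty set gets dimension 0, because ln 0 = 0 in the library. *)
definition upper_box_dim :: "'a::metric_space set \<Rightarrow> ereal" where
  "upper_box_dim A =
     (if totally_bounded A
      then Limsup (at_right 0)
             (\<lambda>\<epsilon>. ereal (ln (real (covering_number \<epsilon> A)) / ln (1 / \<epsilon>)))
      else \<infinity>)"

(* Finite covers are included, since members of the sequence may be empty. *)
definition packing_dim :: "'a::metric_space set \<Rightarrow> ereal" where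
  "packing_dim X =
     (INF Y\<in>{Y :: nat \<Rightarrow> 'a set. (\<forall>i. bounded (Y i)) \<and> X = (\<Union>i. Y i)}.
        SUP i. upper_box_dim (Y i))"

end

theory Submission
  imports Defs
begin

text \<open>
  The embedding is obtained by general position. If \<open>A\<close> and \<open>B\<close> are pieces of \<open>X\<close> that can be
  covered by at most \<open>\<epsilon> powr - s\<close> sets of diameter \<open>\<epsilon>\<close>, and \<open>f\<close> is 1-Lipschitz, then the set of
  differences \<open>f b - f a\<close> is covered by at most \<open>\<epsilon> powr (- 2 * s)\<close> closed balls of radius \<open>2 * \<epsilon>\<close>. When
  \<open>2 * s\<close> is below the dimension of the target, the total volume of these balls tends to \<open>0\<close>, so
  arbitrarily short vectors \<open>t\<close> keep a positive distance from all the differences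
  (\<open>short_translation_separates\<close>). If moreover \<open>A\<close> and \<open>B\<close> have positive distance, there is a
  Lipschitz bump \<open>\<phi>\<close> that is \<open>1\<close> on \<open>A\<close> and \<open>0\<close> on \<open>B\<close>; replacing \<open>f\<close> by \<open>f + \<phi> t\<close> moves the
  image of \<open>A\<close> away from that of \<open>B\<close> and hardly changes \<open>f\<close> or its Lipschitz constant
  (\<open>perturbation_separates\<close>).

  A space of packing dimension \<open>k\<close> is a countable union of sets with such coverings for
  \<open>s = k + 1/4\<close>, and \<open>2 * s < 2 * k + 1\<close>. Cutting these sets with small balls yields countably many
  pairs \<open>(A, B)\<close> at positive distance such that any two distinct points lie in such a pair. The
  perturbations are done for one pair after another, each so small that the gaps won before
  survive; this is the Baire category argument for the space of 1-Lipschitz maps written out. The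
  limit is a 1-Lipschitz injection (\<open>lipschitz_injection\<close>), hence by compactness an embedding.
\<close>

section \<open>Coverings from the packing dimension\<close>

text \<open>
  This is the form in which an upper bound on the upper box dimension is used below. Unlike the
  covering numbers themselves, it passes to subsets at once, which is needed when the pieces are
  cut with balls.
\<close>

definition covered_at_exponent :: "real \<Rightarrow> 'a::metric_space set \<Rightarrow> bool" where
  "covered_at_exponent s A \<longleftrightarrow> (\<forall>\<^sub>F \<epsilon> in at_right 0. \<exists>F. finite F \<and> real (card F) \<le> \<epsilon> powr (- s)
      \<and> A \<subseteq> \<Union>F \<and> (\<forall>U\<in>F. bounded U \<and> diameter U \<le> \<epsilon>))"

lemma covered_at_exponent_subset:
  "covered_at_exponent s A \<Longrightarrow> B \<subseteq> A \<Longrightarrow> covered_at_exponent s B"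
  unfolding covered_at_exponent_def by (erule eventually_mono) blast

lemma covering_number_witness:
  fixes A :: "'a::metric_space set"
  assumes "totally_bounded A" "\<epsilon> > 0"
  shows "\<exists>F. finite F \<and> card F = covering_number \<epsilon> A \<and> A \<subseteq> \<Union>F
           \<and> (\<forall>U\<in>F. bounded U \<and> diameter U \<le> \<epsilon>)"
proof -
  have "\<epsilon> / 2 > 0" using assms by simp
  then obtain K where K: "finite K" "A \<subseteq> (\<Union>x\<in>K. ball x (\<epsilon> / 2))"
    using assms(1) unfolding totally_bounded_metric ball_def by meson
  have "bounded (ball x (\<epsilon> / 2)) \<and> diameter (ball x (\<epsilon> / 2)) \<le> \<epsilon>" for x :: 'a
  proof
    show "diameter (ball x (\<epsilon> / 2)) \<le> \<epsilon>"
    proof -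
      have "dist y z \<le> \<epsilon>" if "y \<in> ball x (\<epsilon> / 2)" "z \<in> ball x (\<epsilon> / 2)" for y z
        using that dist_triangle3[of y z x] by simp
      moreover have "ball x (\<epsilon> / 2) \<noteq> {}" using assms(2) by simp
      ultimately show ?thesis
        unfolding diameter_def by (auto intro!: cSUP_least)
    qed
  qed simp
  then have "\<exists>F. finite F \<and> card F = card ((\<lambda>x. ball x (\<epsilon> / 2)) ` K) \<and> A \<subseteq> \<Union>F
           \<and> (\<forall>U\<in>F. bounded U \<and> diameter U \<le> \<epsilon>)"
    using K by (intro exI[of _ "(\<lambda>x. ball x (\<epsilon> / 2)) ` K"]) auto
  then show ?thesis
    unfolding covering_number_def by (rule LeastI)
qed

lemma upper_box_dim_less_imp_covered:
  fixes A :: "'a::metric_space set"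
  assumes "upper_box_dim A < ereal s"
  shows "covered_at_exponent s A"
proof -
  have tb: "totally_bounded A"
    using assms by (auto simp: upper_box_dim_def split: if_splits)
  then have "\<forall>\<^sub>F \<epsilon> in at_right 0. ereal (ln (real (covering_number \<epsilon> A)) / ln (1 / \<epsilon>)) < ereal s"
    using assms by (intro Limsup_lessD) (simp add: upper_box_dim_def)
  moreover have "\<forall>\<^sub>F \<epsilon> in at_right 0. (0::real) < \<epsilon> \<and> \<epsilon> < 1"
    using eventually_at_right_real[of 0 1] by simp
  ultimately show ?thesis
    unfolding covered_at_exponent_def
  proof eventually_elim
    case (elim \<epsilon>)
    have "ln (1 / \<epsilon>) > 0" using elim by simp
    moreover have "ln (real (covering_number \<epsilon> A)) / ln (1 / \<epsilon>) < s" using elim by simp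
    ultimately have less: "ln (real (covering_number \<epsilon> A)) < s * ln (1 / \<epsilon>)"
      by (simp only: pos_divide_less_eq)
    have "real (covering_number \<epsilon> A) \<le> \<epsilon> powr (- s)"
    proof (cases "covering_number \<epsilon> A = 0")
      case False
      then have "real (covering_number \<epsilon> A) = exp (ln (real (covering_number \<epsilon> A)))" by simp
      also have "\<dots> \<le> exp (s * ln (1 / \<epsilon>))" using less by simp
      also have "\<dots> = \<epsilon> powr (- s)" using elim by (simp add: powr_def ln_div)
      finally show ?thesis .
    qed simp
    then show ?case
      using covering_number_witness[OF tb, of \<epsilon>] elim by auto
  qed
qed

lemma packing_dim_less_imp_countable_cover:
  fixes X :: "'a::metric_space set"
  assumes "packing_dim X < ereal s"
  obtains Y :: "nat \<Rightarrow> 'a set" where "X = (\<Union>i. Y i)" "\<And>i. covered_at_exponent s (Y i)"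
proof -
  obtain Y :: "nat \<Rightarrow> 'a set" where Y: "X = (\<Union>i. Y i)" "(SUP i. upper_box_dim (Y i)) < ereal s"
    using assms unfolding packing_dim_def INF_less_iff by auto
  have "upper_box_dim (Y i) < ereal s" for i
    using Y(2) by (meson SUP_upper UNIV_I le_less_trans)
  then show thesis
    using that[OF Y(1)] upper_box_dim_less_imp_covered by blast
qed

section \<open>Separating two pieces by a small perturbation\<close>

lemma small_balls_do_not_fill_ball:
  fixes c :: "'i \<Rightarrow> 'b::euclidean_space"
  assumes "finite I" "\<rho> \<ge> 0" "r > 0" "real (card I) * \<rho> ^ DIM('b) < r ^ DIM('b)"
  shows "\<exists>t. norm t < r \<and> (\<forall>i\<in>I. t \<notin> cball (c i) \<rho>)"
proof (rule ccontr)
  assume "\<not> ?thesis"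
  then have sub: "ball 0 r \<subseteq> (\<Union>i\<in>I. cball (c i) \<rho>)" by auto
  let ?v = "unit_ball_vol (real DIM('b))"
  have fm: "cball (c i) \<rho> \<in> fmeasurable lborel" for i
    by (simp add: fmeasurable_compact)
  have "?v * r ^ DIM('b) = measure lborel (ball (0::'b) r)"
    using assms by (simp add: content_ball)
  also have "\<dots> \<le> measure lborel (\<Union>i\<in>I. cball (c i) \<rho>)"
    using assms fm by (intro measure_mono_fmeasurable[OF sub] fmeasurable.finite_UN) auto
  also have "\<dots> \<le> (\<Sum>i\<in>I. measure lborel (cball (c i) \<rho>))"
    using assms by (intro measure_UNION_le) auto
  also have "\<dots> = ?v * (real (card I) * \<rho> ^ DIM('b))"
    using assms by (simp add: content_cball)
  also have "\<dots> < ?v * r ^ DIM('b)"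
    using assms by (intro mult_strict_left_mono) auto
  finally show False by simp
qed

text \<open>
  The differences \<open>f b - f a\<close> fill closed balls of total volume proportional to
  \<open>\<epsilon> powr (DIM('b) - 2 * s)\<close>, which for small \<open>\<epsilon>\<close> is less than the volume of a given ball around
  \<open>0\<close>. Since finitely many closed balls form a closed set, a vector outside them has a positive
  distance \<open>\<delta>\<close> from all of them; such a uniform gap is what survives later perturbations.
\<close>

lemma short_translation_separates:
  fixes f :: "'a::metric_space \<Rightarrow> 'b::euclidean_space"
  assumes lip: "1-lipschitz_on (A \<union> B) f"
    and A: "covered_at_exponent s A" and B: "covered_at_exponent s B"
    and s: "2 * s < real DIM('b)" and r: "r > 0"
  shows "\<exists>t \<delta>. norm t < r \<and> \<delta> > 0 \<and> (\<forall>a\<in>A. \<forall>b\<in>B. \<delta> \<le> dist (f a + t) (f b))"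
proof -
  let ?N = "DIM('b)"
  have "((\<lambda>\<epsilon>. 2 ^ ?N * \<epsilon> powr (real ?N - 2 * s)) \<longlongrightarrow> 2 ^ ?N * 0) (at_right 0)"
    using s by (intro tendsto_mult tendsto_const tendsto_zero_powrI[where b = "real ?N - 2 * s"]
      tendsto_ident_at eventually_mono[OF eventually_at_right_less]) auto
  then have "\<forall>\<^sub>F \<epsilon> in at_right 0. 2 ^ ?N * \<epsilon> powr (real ?N - 2 * s) < r ^ ?N"
    using r by (intro order_tendstoD(2)) auto
  moreover have "\<forall>\<^sub>F \<epsilon> in at_right 0. (0::real) < \<epsilon>"
    by (simp add: eventually_at_right_less)
  ultimately have "\<forall>\<^sub>F \<epsilon> in at_right 0. 0 < \<epsilon> \<and> 2 ^ ?N * \<epsilon> powr (real ?N - 2 * s) < r ^ ?N \<and>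
     (\<exists>F. finite F \<and> real (card F) \<le> \<epsilon> powr (- s) \<and> A \<subseteq> \<Union>F \<and> (\<forall>U\<in>F. bounded U \<and> diameter U \<le> \<epsilon>)) \<and>
     (\<exists>F. finite F \<and> real (card F) \<le> \<epsilon> powr (- s) \<and> B \<subseteq> \<Union>F \<and> (\<forall>U\<in>F. bounded U \<and> diameter U \<le> \<epsilon>))"
    using A B unfolding covered_at_exponent_def by eventually_elim (intro conjI)
  from eventually_happens'[OF trivial_limit_at_right_real this]
  obtain \<epsilon> F G where \<epsilon>: "0 < \<epsilon>" "2 ^ ?N * \<epsilon> powr (real ?N - 2 * s) < r ^ ?N"
    and F: "finite F" "real (card F) \<le> \<epsilon> powr (- s)" "A \<subseteq> \<Union>F" "\<And>U. U \<in> F \<Longrightarrow> bounded U \<and> diameter U \<le> \<epsilon>"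
    and G: "finite G" "real (card G) \<le> \<epsilon> powr (- s)" "B \<subseteq> \<Union>G" "\<And>U. U \<in> G \<Longrightarrow> bounded U \<and> diameter U \<le> \<epsilon>"
    by (elim exE conjE) blast
  \<comment> \<open>The balls are centred at the differences of one pair of representatives for each \<open>(U, V)\<close>;
    when \<open>U\<close> misses \<open>A\<close> or \<open>V\<close> misses \<open>B\<close>, the centre is arbitrary and the ball is harmless.\<close>
  define p where "p U = (SOME a. a \<in> U \<inter> A)" for U
  define q where "q V = (SOME b. b \<in> V \<inter> B)" for V
  define c where "c = (\<lambda>(U, V). f (q V) - f (p U))"
  have "real (card (F \<times> G)) * (2 * \<epsilon>) ^ ?N = real (card F) * real (card G) * (2 * \<epsilon>) ^ ?N"
    by (simp add: card_cartesian_product)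
  also have "\<dots> \<le> \<epsilon> powr (- s) * \<epsilon> powr (- s) * (2 * \<epsilon>) ^ ?N"
    using F(2) G(2) \<epsilon> by (intro mult_right_mono mult_mono) auto
  also have "\<dots> = 2 ^ ?N * (\<epsilon> powr (- s) * \<epsilon> powr (- s) * \<epsilon> powr real ?N)"
    using \<epsilon> by (simp add: power_mult_distrib powr_realpow)
  also have "\<dots> = 2 ^ ?N * \<epsilon> powr (real ?N - 2 * s)"
    by (simp add: powr_add[symmetric])
  also have "\<dots> < r ^ ?N" by (rule \<epsilon>)
  finally obtain t where t: "norm t < r" "\<And>i. i \<in> F \<times> G \<Longrightarrow> t \<notin> cball (c i) (2 * \<epsilon>)"
    using small_balls_do_not_fill_ball[of "F \<times> G" "2 * \<epsilon>" r c] F(1) G(1) \<epsilon> r by auto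
  have "open (- (\<Union>i\<in>F \<times> G. cball (c i) (2 * \<epsilon>)))"
    using F(1) G(1) by (intro open_Compl closed_UN) auto
  moreover have "t \<in> - (\<Union>i\<in>F \<times> G. cball (c i) (2 * \<epsilon>))" using t(2) by blast
  ultimately obtain \<delta> where \<delta>: "\<delta> > 0" "ball t \<delta> \<subseteq> - (\<Union>i\<in>F \<times> G. cball (c i) (2 * \<epsilon>))"
    by (meson open_contains_ball)
  have "\<delta> \<le> dist (f a + t) (f b)" if ab: "a \<in> A" "b \<in> B" for a b
  proof -
    obtain U V where U: "U \<in> F" "a \<in> U" and V: "V \<in> G" "b \<in> V" using ab F G by blast
    have p: "p U \<in> U \<inter> A" unfolding p_def using U ab by (metis IntI someI)
    have q: "q V \<in> V \<inter> B" unfolding q_def using V ab by (metis IntI someI)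
    have "dist (f a) (f (p U)) \<le> dist a (p U)"
      using lipschitz_onD[OF lip, of a "p U"] p ab by auto
    also have "\<dots> \<le> \<epsilon>"
      using diameter_bounded_bound[of U a "p U"] F(4)[OF U(1)] U p by auto
    finally have a: "dist (f a) (f (p U)) \<le> \<epsilon>" .
    have "dist (f b) (f (q V)) \<le> dist b (q V)"
      using lipschitz_onD[OF lip, of b "q V"] q ab by auto
    also have "\<dots> \<le> \<epsilon>"
      using diameter_bounded_bound[of V b "q V"] G(4)[OF V(1)] V q by auto
    finally have b: "dist (f b) (f (q V)) \<le> \<epsilon>" .
    have "dist (c (U, V)) (f b - f a) \<le> dist (f b) (f (q V)) + dist (f a) (f (p U))"
      unfolding c_def by (simp add: dist_norm) norm
    then have "f b - f a \<in> cball (c (U, V)) (2 * \<epsilon>)" using a b by auto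
    then have "f b - f a \<notin> ball t \<delta>" using \<delta>(2) U V by blast
    then show ?thesis by (simp add: dist_norm algebra_simps)
  qed
  then show ?thesis using t \<delta> by blast
qed

lemma lipschitz_bump:
  fixes A B X :: "'a::metric_space set"
  assumes "e > 0" "A \<noteq> {}" and sep: "\<And>a b. a \<in> A \<Longrightarrow> b \<in> B \<Longrightarrow> e \<le> dist a b"
  obtains \<phi> :: "'a \<Rightarrow> real" where "(1 / e)-lipschitz_on X \<phi>" "\<And>x. 0 \<le> \<phi> x \<and> \<phi> x \<le> 1"
    "\<And>a. a \<in> A \<Longrightarrow> \<phi> a = 1" "\<And>b. b \<in> B \<Longrightarrow> \<phi> b = 0"
proof
  let ?\<phi> = "\<lambda>x. max 0 (1 - infdist x A / e)"
  show "(1 / e)-lipschitz_on X ?\<phi>"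
  proof (rule lipschitz_onI)
    fix x y
    have "\<bar>infdist x A - infdist y A\<bar> \<le> dist x y"
      by (rule infdist_triangle_abs)
    then have "\<bar>infdist x A / e - infdist y A / e\<bar> \<le> 1 / e * dist x y"
      using \<open>e > 0\<close> by (simp add: diff_divide_distrib[symmetric] divide_right_mono)
    then show "dist (?\<phi> x) (?\<phi> y) \<le> 1 / e * dist x y"
      unfolding dist_real_def by linarith
  qed (use \<open>e > 0\<close> in simp)
  show "0 \<le> ?\<phi> x \<and> ?\<phi> x \<le> 1" for x
    using \<open>e > 0\<close> by (simp add: infdist_nonneg)
  show "?\<phi> a = 1" if "a \<in> A" for a using that by simp
  show "?\<phi> b = 0" if "b \<in> B" for b
  proof -
    have "e \<le> infdist b A"
      using assms that by (auto simp: infdist_notempty dist_commute intro!: cINF_greatest)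
    then show ?thesis using \<open>e > 0\<close> by simp
  qed
qed

lemma perturbation_separates:
  fixes f :: "'a::metric_space \<Rightarrow> 'b::euclidean_space"
  assumes lip: "L-lipschitz_on X f" and L: "L < 1" and sub: "A \<subseteq> X" "B \<subseteq> X"
    and cov: "covered_at_exponent s A" "covered_at_exponent s B"
    and s: "2 * s < real DIM('b)" and r: "r > 0"
    and e: "e > 0" and sep: "\<And>a b. a \<in> A \<Longrightarrow> b \<in> B \<Longrightarrow> e \<le> dist a b"
  shows "\<exists>f' L' \<delta>. L'-lipschitz_on X f' \<and> L' < 1 \<and> (\<forall>x\<in>X. dist (f' x) (f x) \<le> r) \<and> \<delta> > 0
           \<and> (\<forall>a\<in>A. \<forall>b\<in>B. \<delta> \<le> dist (f' a) (f' b))"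
proof (cases "A = {}")
  case True
  then show ?thesis using lip L r by (intro exI[of _ f] exI[of _ L] exI[of _ 1]) auto
next
  case False
  obtain \<phi> :: "'a \<Rightarrow> real" where \<phi>: "(1 / e)-lipschitz_on X \<phi>" "\<And>x. 0 \<le> \<phi> x \<and> \<phi> x \<le> 1"
    "\<And>a. a \<in> A \<Longrightarrow> \<phi> a = 1" "\<And>b. b \<in> B \<Longrightarrow> \<phi> b = 0"
    using lipschitz_bump[OF e False sep, where X = X] by blast
  \<comment> \<open>The bump \<open>\<phi>\<close> times \<open>t\<close> has Lipschitz constant \<open>norm t / e\<close>, which must stay below \<open>1 - L\<close>.\<close>
  have "min r (e * (1 - L)) > 0" using r e L by simp
  moreover have "1-lipschitz_on (A \<union> B) f"
    using lipschitz_on_subset[OF lipschitz_on_le[OF lip, of 1]] L sub by auto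
  ultimately obtain t \<delta> where t: "norm t < min r (e * (1 - L))" and \<delta>: "\<delta> > 0"
    "\<And>a b. a \<in> A \<Longrightarrow> b \<in> B \<Longrightarrow> \<delta> \<le> dist (f a + t) (f b)"
    using short_translation_separates[OF _ cov s] by meson
  have "(norm t / e)-lipschitz_on X (\<lambda>x. \<phi> x *\<^sub>R t)"
  proof (rule lipschitz_onI)
    fix x y assume "x \<in> X" "y \<in> X"
    then have "dist (\<phi> x) (\<phi> y) \<le> 1 / e * dist x y" using lipschitz_onD[OF \<phi>(1)] by blast
    then have "dist (\<phi> x) (\<phi> y) * norm t \<le> 1 / e * dist x y * norm t"
      by (intro mult_right_mono) auto
    then show "dist (\<phi> x *\<^sub>R t) (\<phi> y *\<^sub>R t) \<le> norm t / e * dist x y"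
      by (simp add: dist_norm scaleR_diff_left[symmetric] mult_ac)
  qed (use e in simp)
  then have "(L + norm t / e)-lipschitz_on X (\<lambda>x. f x + \<phi> x *\<^sub>R t)"
    by (intro lipschitz_on_add lip)
  moreover have "L + norm t / e < 1"
    using t e by (simp add: field_simps)
  moreover have "dist (f x + \<phi> x *\<^sub>R t) (f x) \<le> r" for x
  proof -
    have "\<phi> x * norm t \<le> 1 * norm t" using \<phi>(2)[of x] by (intro mult_right_mono) auto
    then show ?thesis using t \<phi>(2)[of x] by (simp add: dist_norm)
  qed
  moreover have "\<forall>a\<in>A. \<forall>b\<in>B. \<delta> \<le> dist (f a + \<phi> a *\<^sub>R t) (f b + \<phi> b *\<^sub>R t)"
    using \<delta>(2) \<phi>(3,4) by simp
  ultimately show ?thesis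
    using \<delta>(1) by (intro exI[of _ "\<lambda>x. f x + \<phi> x *\<^sub>R t"] exI[of _ "L + norm t / e"] exI[of _ \<delta>]) auto
qed

section \<open>Separating countably many pairs\<close>

text \<open>
  The induction carries a budget \<open>d n\<close>: all later changes together move no point by more than
  \<open>d n\<close>, and \<open>d (Suc n)\<close> is chosen at most a third of the gap between the images of \<open>A n\<close> and
  \<open>B n\<close>, so that this gap survives in the limit. The Lipschitz constants increase but stay below
  \<open>1\<close>, which leaves room for every further step.
\<close>

lemma lipschitz_map_separating_sequence:
  fixes A B :: "nat \<Rightarrow> 'a::metric_space set"
  assumes sub: "\<And>n. A n \<subseteq> X" "\<And>n. B n \<subseteq> X"
    and cov: "\<And>n. covered_at_exponent s (A n)" "\<And>n. covered_at_exponent s (B n)"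
    and sep: "\<And>n. \<exists>e>0. \<forall>a\<in>A n. \<forall>b\<in>B n. e \<le> dist a b"
    and s: "2 * s < real DIM('b::euclidean_space)"
  obtains g :: "'a \<Rightarrow> 'b::euclidean_space" where "1-lipschitz_on X g"
    "\<And>n a b. a \<in> A n \<Longrightarrow> b \<in> B n \<Longrightarrow> g a \<noteq> g b"
proof -
  define P :: "nat \<Rightarrow> ('a \<Rightarrow> 'b) \<times> real \<Rightarrow> bool" where
    "P = (\<lambda>n (f, d). (\<exists>L<1. L-lipschitz_on X f) \<and> d > 0)"
  define Q :: "nat \<Rightarrow> ('a \<Rightarrow> 'b) \<times> real \<Rightarrow> ('a \<Rightarrow> 'b) \<times> real \<Rightarrow> bool" where
    "Q = (\<lambda>n (f, d) (f', d'). d' \<le> d / 2 \<and> (\<forall>x\<in>X. dist (f' x) (f x) \<le> d / 2)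
            \<and> (\<forall>a\<in>A n. \<forall>b\<in>B n. 3 * d' \<le> dist (f' a) (f' b)))"
  have "\<exists>h. \<forall>n. P n (h n) \<and> Q n (h n) (h (Suc n))"
  proof (rule dependent_nat_choice)
    have "0-lipschitz_on X (\<lambda>_. 0::'b)" by (simp add: lipschitz_on_def)
    then have "\<exists>L<1. L-lipschitz_on X (\<lambda>_. 0::'b)" using zero_less_one by blast
    then have "P 0 (\<lambda>_. 0, 1)" unfolding P_def by simp
    then show "\<exists>h. P 0 h" ..
  next
    fix h n assume "P n h"
    then obtain f d L where h: "h = (f, d)" "L < 1" "L-lipschitz_on X f" "d > 0"
      by (auto simp: P_def)
    obtain e where e: "e > 0" "\<And>a b. a \<in> A n \<Longrightarrow> b \<in> B n \<Longrightarrow> e \<le> dist a b" using sep by meson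
    obtain f' L' \<delta> where f': "L'-lipschitz_on X f'" "L' < 1" "\<forall>x\<in>X. dist (f' x) (f x) \<le> d / 2"
      "\<delta> > 0" "\<forall>a\<in>A n. \<forall>b\<in>B n. \<delta> \<le> dist (f' a) (f' b)"
      using perturbation_separates[OF h(3,2) sub cov s half_gt_zero[OF h(4)] e] by blast
    have "\<delta> \<le> dist (f' a) (f' b) \<Longrightarrow> 3 * min (d / 2) (\<delta> / 3) \<le> dist (f' a) (f' b)" for a b
      by linarith
    then show "\<exists>h'. P (Suc n) h' \<and> Q n h h'"
      using h f' unfolding P_def Q_def
      by (intro exI[of _ "(f', min (d / 2) (\<delta> / 3))"]) auto
  qed
  then obtain h where h: "\<And>n. P n (h n)" "\<And>n. Q n (h n) (h (Suc n))" by blast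
  define f where "f n = fst (h n)" for n
  define d where "d n = snd (h n)" for n
  have f_lip: "1-lipschitz_on X (f n)" and d_pos: "d n > 0" for n
    using h(1)[of n] by (auto simp: P_def f_def d_def split_beta intro: lipschitz_on_le less_imp_le)
  have d_half: "d (Suc n) \<le> d n / 2"
    and f_step: "x \<in> X \<Longrightarrow> dist (f (Suc n) x) (f n x) \<le> d n / 2"
    and gap: "a \<in> A n \<Longrightarrow> b \<in> B n \<Longrightarrow> 3 * d (Suc n) \<le> dist (f (Suc n) a) (f (Suc n) b)" for n x a b
    using h(2)[of n] by (auto simp: Q_def f_def d_def split_beta)
  \<comment> \<open>The budgets halve, so a change by \<open>d n / 2\<close> is paid for by \<open>d n - d (Suc n)\<close>, and the sum
    telescopes.\<close>
  have drift: "dist (f (n + j) x) (f n x) \<le> d n - d (n + j)" if "x \<in> X" for n j x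
  proof (induction j)
    case (Suc j)
    have "dist (f (n + Suc j) x) (f n x) \<le> dist (f (Suc (n + j)) x) (f (n + j) x) + dist (f (n + j) x) (f n x)"
      using dist_triangle by simp
    then show ?case using Suc f_step[OF that, of "n + j"] d_half[of "n + j"] by simp
  qed simp
  have d_le: "d n \<le> d 0 * (1 / 2) ^ n" for n
  proof (induction n)
    case (Suc n)
    then show ?case using d_half[of n] by simp
  qed simp
  have d_null: "d \<longlonglongrightarrow> 0"
  proof (rule Lim_null_comparison)
    show "(\<lambda>n. d 0 * (1 / 2) ^ n) \<longlonglongrightarrow> 0" by (intro tendsto_mult_right_zero LIMSEQ_power_zero) simp
    show "\<forall>\<^sub>F n in sequentially. norm (d n) \<le> d 0 * (1 / 2) ^ n"
      using d_pos d_le by (simp add: less_imp_le)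
  qed
  have "Cauchy (\<lambda>n. f n x)" if "x \<in> X" for x
  proof (rule metric_CauchyI)
    fix e :: real assume "e > 0"
    then have "\<forall>\<^sub>F n in sequentially. d n < e / 2"
      using order_tendstoD(2)[OF d_null, of "e / 2"] by simp
    then obtain M where M: "d M < e / 2" by (auto simp: eventually_sequentially)
    have "dist (f m x) (f M x) < e / 2" if "m \<ge> M" for m
      using drift[OF \<open>x \<in> X\<close>, of M "m - M"] d_pos[of m] M that by simp
    then show "\<exists>M. \<forall>m\<ge>M. \<forall>n\<ge>M. dist (f m x) (f n x) < e"
      by (intro exI[of _ M] allI impI) (rule dist_triangle_half_l)
  qed
  then have "\<forall>x\<in>X. \<exists>l. (\<lambda>n. f n x) \<longlonglongrightarrow> l"
    by (auto simp: Cauchy_convergent_iff convergent_def)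
  then obtain g where g: "\<And>x. x \<in> X \<Longrightarrow> (\<lambda>n. f n x) \<longlonglongrightarrow> g x" by metis
  have g_near: "dist (g x) (f n x) \<le> d n" if "x \<in> X" for n x
  proof (rule tendsto_upperbound)
    show "(\<lambda>j. dist (f (j + n) x) (f n x)) \<longlonglongrightarrow> dist (g x) (f n x)"
      using LIMSEQ_ignore_initial_segment[OF g[OF that], of n] by (intro tendsto_intros)
    show "\<forall>\<^sub>F j in sequentially. dist (f (j + n) x) (f n x) \<le> d n"
    proof (rule always_eventually, rule allI)
      show "dist (f (j + n) x) (f n x) \<le> d n" for j
        using drift[OF that, of n j] d_pos[of "n + j"] by (simp add: add.commute)
    qed
  qed simp
  show thesis
  proof
    show "1-lipschitz_on X g"
    proof (rule lipschitz_onI)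
      fix x y assume xy: "x \<in> X" "y \<in> X"
      show "dist (g x) (g y) \<le> 1 * dist x y"
        using xy lipschitz_onD[OF f_lip]
        by (intro tendsto_upperbound[OF tendsto_dist[OF g g]] always_eventually) auto
    qed simp
    show "g a \<noteq> g b" if ab: "a \<in> A n" "b \<in> B n" for n a b
    proof
      assume eq: "g a = g b"
      have "dist (f (Suc n) a) (f (Suc n) b) \<le> dist (g a) (f (Suc n) a) + dist (g a) (f (Suc n) b)"
        by (rule dist_triangle3)
      also have "\<dots> \<le> 2 * d (Suc n)"
        using g_near[OF subsetD[OF sub(1) ab(1)], of "Suc n"]
          g_near[OF subsetD[OF sub(2) ab(2)], of "Suc n"] eq by simp
      finally show False using gap[OF ab] d_pos[of "Suc n"] by simp
    qed
  qed
qed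

text \<open>
  The pairs that have to be separated come from the sets \<open>Y i \<inter> ball q (1 / (n + 1))\<close>, where \<open>q\<close>
  runs through a finite \<open>1 / (n + 1)\<close>-net of \<open>X\<close>: these are countably many, and two points at
  distance more than \<open>4 / (n + 1)\<close> lie in two of them at positive distance.
\<close>

lemma lipschitz_injection:
  fixes X :: "'a::metric_space set"
  assumes "totally_bounded X" and X: "X = (\<Union>i::nat. Y i)"
    and cov: "\<And>i. covered_at_exponent s (Y i)"
    and s: "2 * s < real DIM('b::euclidean_space)"
  obtains g :: "'a \<Rightarrow> 'b::euclidean_space" where "1-lipschitz_on X g" "inj_on g X"
proof -
  have "\<forall>n::nat. \<exists>K. finite K \<and> X \<subseteq> (\<Union>q\<in>K. ball q (1 / (n + 1)))"
    using assms(1) unfolding totally_bounded_metric by (simp add: ball_def)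
  then obtain K where K: "\<And>n::nat. finite (K n)" "\<And>n. X \<subseteq> (\<Union>q\<in>K n. ball q (1 / (n + 1)))" by metis
  define pieces where "pieces = (\<Union>n. \<Union>i. \<Union>q\<in>K n. {Y i \<inter> ball q (1 / (real n + 1))})"
  define pairs where
    "pairs = {(A, B). A \<in> pieces \<and> B \<in> pieces \<and> (\<exists>e>0. \<forall>a\<in>A. \<forall>b\<in>B. e \<le> dist a b)}"
  have "countable pieces"
    unfolding pieces_def using K(1) by (intro countable_UN countable_finite[OF K(1)]) auto
  then have "countable (pieces \<times> pieces)" by (intro countable_SIGMA)
  then have countable: "countable pairs"
    by (rule countable_subset[rotated]) (auto simp: pairs_def)
  have piece: "A \<subseteq> X \<and> covered_at_exponent s A" if "A \<in> pieces" for A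
    using that cov X unfolding pieces_def by (auto intro: covered_at_exponent_subset)
  have in_pair: "\<exists>(A, B)\<in>pairs. x \<in> A \<and> y \<in> B" if xy: "x \<in> X" "y \<in> X" "x \<noteq> y" for x y
  proof -
    obtain n where "inverse (real (Suc n)) < dist x y / 4"
      using reals_Archimedean[of "dist x y / 4"] xy by auto
    then have n: "4 * (1 / (real n + 1)) < dist x y" by (simp add: inverse_eq_divide add.commute)
    define \<rho> where "\<rho> = 1 / (real n + 1)"
    obtain p q where p: "p \<in> K n" "x \<in> ball p \<rho>" and q: "q \<in> K n" "y \<in> ball q \<rho>"
      using xy K(2)[of n] unfolding \<rho>_def by (blast elim: UN_E)
    obtain i j where i: "x \<in> Y i" and j: "y \<in> Y j" using xy X by blast
    have "dist x y - 4 * \<rho> \<le> dist a b" if "a \<in> ball p \<rho>" "b \<in> ball q \<rho>" for a b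
      using that p q dist_triangle[of x y a] dist_triangle[of a y b] dist_triangle3[of x a p]
        dist_triangle3[of b y q] by simp
    then have "(Y i \<inter> ball p \<rho>, Y j \<inter> ball q \<rho>) \<in> pairs"
      using p q n unfolding pairs_def pieces_def \<rho>_def[symmetric]
      by (auto simp: \<rho>_def intro!: exI[of _ "dist x y - 4 * \<rho>"])
    then show ?thesis
      by (rule bexI[rotated]) (use p(2) q(2) i j in simp)
  qed
  show thesis
  proof (cases "pairs = {}")
    case True
    then have "inj_on (\<lambda>_. 0::'b) X" using in_pair by (auto simp: inj_on_def)
    then show thesis using that[of "\<lambda>_. 0"] by (simp add: lipschitz_on_def)
  next
    case False
    define A where "A n = fst (from_nat_into pairs n)" for n
    define B where "B n = snd (from_nat_into pairs n)" for n
    have AB: "(A n, B n) \<in> pairs" for n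
      using from_nat_into[OF False] by (simp add: A_def B_def)
    then have props: "A n \<in> pieces" "B n \<in> pieces" "\<exists>e>0. \<forall>a\<in>A n. \<forall>b\<in>B n. e \<le> dist a b" for n
      by (auto simp: pairs_def)
    obtain g :: "'a \<Rightarrow> 'b" where g: "1-lipschitz_on X g"
      "\<And>n a b. a \<in> A n \<Longrightarrow> b \<in> B n \<Longrightarrow> g a \<noteq> g b"
      using lipschitz_map_separating_sequence[of A X B s] piece props s by blast
    have "inj_on g X"
    proof (rule inj_onI, rule ccontr)
      fix x y assume xy: "x \<in> X" "y \<in> X" "g x = g y" "x \<noteq> y"
      then obtain A' B' where *: "(A', B') \<in> pairs" "x \<in> A'" "y \<in> B'" using in_pair by blast
      then obtain n where "from_nat_into pairs n = (A', B')"
        using from_nat_into_surj[OF countable] by blast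
      then show False using g(2)[of x n y] * xy by (simp add: A_def B_def)
    qed
    then show thesis using that g by blast
  qed
qed

theorem theorem2p9:
  fixes X :: "'a::metric_space set" and k :: real
  assumes "compact X"
    and "packing_dim X = ereal k"
    and "real CARD('n::finite) = 2 * k + 1"
  shows "\<exists>(f :: 'a \<Rightarrow> real ^ 'n) g C. C-lipschitz_on X f \<and> homeomorphism X (f ` X) f g"
proof -
  \<comment> \<open>Any exponent strictly between \<open>k\<close> and \<open>k + 1/2\<close> would do.\<close>
  have "packing_dim X < ereal (k + 1 / 4)" using assms(2) by simp
  then obtain Y :: "nat \<Rightarrow> 'a set" where Y: "X = (\<Union>i. Y i)" "\<And>i. covered_at_exponent (k + 1 / 4) (Y i)"
    using packing_dim_less_imp_countable_cover[of X "k + 1 / 4" thesis] by simp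
  have "totally_bounded X"
    using assms(1) by (simp add: compact_eq_totally_bounded totally_bounded_metric ball_def)
  moreover have "2 * (k + 1 / 4) < real DIM(real ^ 'n)" using assms(3) by simp
  ultimately obtain f :: "'a \<Rightarrow> real ^ 'n" where f: "1-lipschitz_on X f" "inj_on f X"
    using lipschitz_injection[OF _ Y, where ?'b = "real ^ 'n" and thesis = thesis] by simp
  have "continuous_on X f" using f(1) by (rule lipschitz_on_continuous_on)
  then obtain g where "homeomorphism X (f ` X) f g"
    using homeomorphism_compact[OF assms(1) _ refl f(2)] by blast
  then show ?thesis using f(1) by blast
qed

end
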